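(* Let $0<\alpha<1$, $\lambda\ge0$, $a>0$, $y_a,z_a\in\mathbb{R}$, let $J\subseteq\mathbb{R}$ be an interval and let $f:[0,a]\times J\to\mathbb{R}$ be continuous and satisfy $|f(t,u)-f(t,v)|\le L|u-v|$ for all $t\in[0,a]$, $u,v\in J$, where $0<L<\dfrac{\Gamma(\alpha+1)}{2a^{\alpha}e^{\lambda a}}$. Let $y$ and $z$ be the unique ($J$-valued) solutions of the terminal value problems $$\mathbb{D}^{\alpha,\lambda}(y(t))=f(t,y(t)),\ t\in[0,a],\quad e^{\lambda a}y(a)=y_a,$$ and $$\mathbb{D}^{\alpha,\lambda}(z(t))=f(t,z(t)),\ t\in[0,a],\quad e^{\lambda a}z(a)=z_a,$$ respectively. Then $$\|y-z\|\le\frac{1}{\beta}\,|y_a-z_a|,\qquad\text{where}\quad \beta=1-\frac{2Le^{\lambda a}a^{\alpha}}{\Gamma(\alpha+1)}.$$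
   Context: $\|g\|=\max_{t\in[0,a]}|g(t)|$ for $g\in C([0,a])$. For $0<\alpha<1$ and $\lambda\ge0$ the (left-sided) Caputo tempered fractional derivative is $$\mathbb{D}^{\alpha,\lambda}(y(t))=\frac{e^{-\lambda t}}{\Gamma(1-\alpha)}\int_0^t (t-s)^{-\alpha}\frac{d}{ds}\left(e^{\lambda s}y(s)\right)ds.$$ Solutions are understood via the equivalent integral equation: a solution of $\mathbb{D}^{\alpha,\lambda}(y(t))=f(t,y(t))$ on $[0,a]$ with $e^{\lambda a}y(a)=y_a$ is a continuous function $y:[0,a]\to J$ such that for all $t\in[0,a]$ $$y(t)=y_a e^{-\lambda t}-\frac{e^{-\lambda t}}{\Gamma(\alpha)}\int_0^a e^{\lambda s}(a-s)^{\alpha-1}f(s,y(s))\,ds+\frac{e^{-\lambda t}}{\Gamma(\alpha)}\int_0^t e^{\lambda s}(t-s)^{\alpha-1}f(s,y(s))\,ds,$$ and similarly for $z$ with $z_a$ in place of $y_a$. *)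

theory Defs
  imports "HOL-Analysis.Analysis"
begin

text \<open>The norm of \<open>C([0,a])\<close>. It is only meaningful for \<open>g\<close> continuous on \<open>[0,a]\<close> with
  \<open>a \<ge> 0\<close>; the supremum is then attained, see \<open>sup_norm_attained\<close>.\<close>

definition sup_norm :: "real \<Rightarrow> (real \<Rightarrow> real) \<Rightarrow> real" where
  "sup_norm a g = (SUP t\<in>{0..a}. \<bar>g t\<bar>)"

lemma sup_norm_attained:
  assumes "0 \<le> a" and "continuous_on {0..a} g"
  shows "\<exists>t\<in>{0..a}. sup_norm a g = \<bar>g t\<bar> \<and> (\<forall>s\<in>{0..a}. \<bar>g s\<bar> \<le> \<bar>g t\<bar>)"
proof -
  have "continuous_on {0..a} (\<lambda>t. \<bar>g t\<bar>)"
    using assms(2) by (intro continuous_intros)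
  then obtain t where t: "t \<in> {0..a}" "\<forall>s\<in>{0..a}. \<bar>g s\<bar> \<le> \<bar>g t\<bar>"
    using continuous_attains_sup[of "{0..a}" "\<lambda>t. \<bar>g t\<bar>"] assms(1) by auto
  then have "sup_norm a g = \<bar>g t\<bar>"
    unfolding sup_norm_def by (intro cSup_eq_maximum) auto
  with t show ?thesis by blast
qed

text \<open>Solutions on \<open>[0,a]\<close>, with values in \<open>J\<close>, of the terminal value problem for the Caputo
  tempered fractional derivative of order \<open>\<alpha>\<close> with parameter \<open>lam\<close>,
  \<open>D y(t) = f(t, y(t))\<close> with \<open>e^{lam a} y(a) = y\<^sub>a\<close>, where
  \<open>D y(t) = e^{-lam t} / \<Gamma>(1 - \<alpha>) \<cdot> \<integral>\<^sub>0\<^sup>t (t - s)^{-\<alpha>} (d/ds) (e^{lam s} y(s)) ds\<close>.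
  Solutions are understood through the equivalent integral equation, so that \<open>y\<close> is only required
  to be continuous. At \<open>t = a\<close> the two integral terms cancel, which gives the terminal condition.

  The kernels \<open>(a - s)^{\<alpha> - 1}\<close> and \<open>(t - s)^{\<alpha> - 1}\<close> are singular at the upper endpoint, where
  \<open>powr\<close> returns \<open>0\<close>; a single point does not affect the integrals.\<close>

definition is_tvp_solution ::
  "real \<Rightarrow> real \<Rightarrow> real \<Rightarrow> real set \<Rightarrow> (real \<Rightarrow> real \<Rightarrow> real) \<Rightarrow> real \<Rightarrow> (real \<Rightarrow> real) \<Rightarrow> bool" where
  "is_tvp_solution \<alpha> lam a J f ya y \<longleftrightarrow>
     continuous_on {0..a} y \<and> (\<forall>t\<in>{0..a}. y t \<in> J) \<and>
     (\<forall>t\<in>{0..a}. y t = ya * exp (- lam * t)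
        - exp (- lam * t) / Gamma \<alpha> *
            integral {0..a} (\<lambda>s. exp (lam * s) * (a - s) powr (\<alpha> - 1) * f s (y s))
        + exp (- lam * t) / Gamma \<alpha> *
            integral {0..t} (\<lambda>s. exp (lam * s) * (t - s) powr (\<alpha> - 1) * f s (y s)))"

end

theory Submission
  imports Defs
begin

text \<open>At a point \<open>t\<close> where \<open>M = \<parallel>y - z\<parallel>\<close> is attained, the integral equations are subtracted. By
  the Lipschitz condition each of the two integrals of the difference is at most
  \<open>e^{lam a} L M a^\<alpha> / \<alpha>\<close>, and \<open>e^{-lam t} \<le> 1\<close>, so \<open>M \<le> \<bar>y\<^sub>a - z\<^sub>a\<bar> + (1 - \<beta>) M\<close>.\<close>

text \<open>The antiderivative \<open>- ((t - s) powr \<alpha> / \<alpha>)\<close> is continuous up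
  to \<open>s = t\<close> because \<open>0 < \<alpha>\<close>, but need not be differentiable there.
  Hence the fundamental theorem is used in the form that asks for a derivative only in the
  interior.\<close>

lemma has_integral_powr_diff:
  fixes \<alpha> t :: real
  assumes "0 < \<alpha>" "0 \<le> t"
  shows "((\<lambda>s. (t - s) powr (\<alpha> - 1)) has_integral t powr \<alpha> / \<alpha>) {0..t}"
proof -
  have "((\<lambda>s. (t - s) powr (\<alpha> - 1)) has_integral
      (- ((t - t) powr \<alpha> / \<alpha>)) - (- ((t - 0) powr \<alpha> / \<alpha>))) {0..t}"
  proof (rule fundamental_theorem_of_calculus_interior)
    show "continuous_on {0..t} (\<lambda>s. - ((t - s) powr \<alpha> / \<alpha>))"
      using assms by (intro continuous_intros continuous_on_powr') auto
    show "((\<lambda>s. - ((t - s) powr \<alpha> / \<alpha>)) has_vector_derivative (t - s) powr (\<alpha> - 1)) (at s)"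
      if "s \<in> {0<..<t}" for s
      unfolding has_real_derivative_iff_has_vector_derivative[symmetric]
      using assms that by (auto intro!: derivative_eq_intros)
  qed (use assms in auto)
  then show ?thesis using assms by simp
qed

text \<open>For \<open>\<alpha> < 1\<close> the kernel is unbounded near \<open>s = t\<close>, so
  continuity alone does not give integrability. Being nonnegative with a finite integral, the kernel
  is absolutely integrable, and this survives multiplication by the bounded measurable function
  \<open>g\<close>.\<close>

lemma integrable_powr_diff_mult:
  fixes \<alpha> t :: real and g :: "real \<Rightarrow> real"
  assumes "0 < \<alpha>" "0 \<le> t" "continuous_on {0..t} g"
  shows "(\<lambda>s. (t - s) powr (\<alpha> - 1) * g s) integrable_on {0..t}"
proof -
  have "(\<lambda>s. (t - s) powr (\<alpha> - 1)) absolutely_integrable_on {0..t}"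
    using has_integral_powr_diff[OF assms(1,2)]
    by (intro nonnegative_absolutely_integrable_1) (auto simp: has_integral_iff)
  moreover have "g \<in> borel_measurable (lebesgue_on {0..t})"
    using assms(3) by (intro continuous_imp_measurable_on_sets_lebesgue) auto
  moreover have "bounded (g ` {0..t})"
    using assms(3) by (intro compact_imp_bounded compact_continuous_image) auto
  ultimately have "(\<lambda>s. g s * (t - s) powr (\<alpha> - 1)) absolutely_integrable_on {0..t}"
    by (intro absolutely_integrable_bounded_measurable_product_real) auto
  then show ?thesis
    by (simp add: mult.commute set_lebesgue_integral_eq_integral(1))
qed

text \<open>Since the kernel is nonnegative, the integrand is dominated by \<open>K\<close> times
  the kernel, whose integral is known exactly.\<close>

lemma abs_integral_powr_diff_mult_le:
  fixes \<alpha> t K :: real and g :: "real \<Rightarrow> real"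
  assumes "0 < \<alpha>" "0 \<le> t" "continuous_on {0..t} g" and g: "\<And>s. s \<in> {0..t} \<Longrightarrow> \<bar>g s\<bar> \<le> K"
  shows "\<bar>integral {0..t} (\<lambda>s. (t - s) powr (\<alpha> - 1) * g s)\<bar> \<le> K * (t powr \<alpha> / \<alpha>)"
proof -
  have k: "((\<lambda>s. K * (t - s) powr (\<alpha> - 1)) has_integral K * (t powr \<alpha> / \<alpha>)) {0..t}"
    by (intro has_integral_mult_right has_integral_powr_diff assms)
  have "norm (integral {0..t} (\<lambda>s. (t - s) powr (\<alpha> - 1) * g s))
      \<le> integral {0..t} (\<lambda>s. K * (t - s) powr (\<alpha> - 1))"
  proof (rule integral_norm_bound_integral)
    show "norm ((t - s) powr (\<alpha> - 1) * g s) \<le> K * (t - s) powr (\<alpha> - 1)" if "s \<in> {0..t}" for s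
      using mult_right_mono[OF g[OF that], of "(t - s) powr (\<alpha> - 1)"]
      by (simp add: abs_mult mult.commute)
  qed (use k integrable_powr_diff_mult[OF assms(1-3)] in \<open>auto simp: has_integral_iff\<close>)
  also have "\<dots> = K * (t powr \<alpha> / \<alpha>)"
    using k by (simp add: has_integral_iff)
  finally show ?thesis by simp
qed

theorem theorem4:
  fixes \<alpha> lam a L ya za :: real
    and J :: "real set"
    and f :: "real \<Rightarrow> real \<Rightarrow> real"
    and y z :: "real \<Rightarrow> real"
  assumes "0 < \<alpha>" and "\<alpha> < 1" and "0 \<le> lam" and "0 < a"
    and "is_interval J"
    and "continuous_on ({0..a} \<times> J) (\<lambda>(t, u). f t u)"
    and "\<forall>t\<in>{0..a}. \<forall>u\<in>J. \<forall>v\<in>J. \<bar>f t u - f t v\<bar> \<le> L * \<bar>u - v\<bar>"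
    and "0 < L" and "L < Gamma (\<alpha> + 1) / (2 * a powr \<alpha> * exp (lam * a))"
    and "is_tvp_solution \<alpha> lam a J f ya y"
    and "is_tvp_solution \<alpha> lam a J f za z"
  shows "let \<beta> = 1 - 2 * L * exp (lam * a) * a powr \<alpha> / Gamma (\<alpha> + 1)
         in sup_norm a (\<lambda>t. y t - z t) \<le> 1 / \<beta> * \<bar>ya - za\<bar>"
proof -
  \<comment> \<open>\<open>I g t / Gamma \<alpha>\<close> is the Riemann-Liouville fractional
    integral of order \<open>\<alpha>\<close>. With the weight \<open>exp (lam * s)\<close> moved
    into \<open>G\<close>, the two integrals in \<open>is_tvp_solution\<close> are
    \<open>I (G w) a\<close> and \<open>I (G w) t\<close>.\<close>
  define I where "I g t = integral {0..t} (\<lambda>s. (t - s) powr (\<alpha> - 1) * g s)" for g t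
  define G where "G w s = exp (lam * s) * f s (w s)" for w s
  define D where "D s = G y s - G z s" for s
  define M where "M = sup_norm a (\<lambda>t. y t - z t)"
  \<comment> \<open>This will bound \<open>D\<close> on \<open>{0..a}\<close>: the weight is at most
    \<open>exp (lam * a)\<close>, and the Lipschitz condition contributes
    \<open>L * M\<close>.\<close>
  define K where "K = exp (lam * a) * (L * M)"
  define \<beta> where "\<beta> = 1 - 2 * L * exp (lam * a) * a powr \<alpha> / Gamma (\<alpha> + 1)"
  have yz: "continuous_on {0..a} y" "continuous_on {0..a} z"
    and yzJ: "\<And>t. t \<in> {0..a} \<Longrightarrow> y t \<in> J" "\<And>t. t \<in> {0..a} \<Longrightarrow> z t \<in> J"
    using assms(10,11) by (auto simp: is_tvp_solution_def)
  have G: "continuous_on {0..a} (G w)"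
    if "continuous_on {0..a} w" "\<And>t. t \<in> {0..a} \<Longrightarrow> w t \<in> J" for w
  proof -
    have "continuous_on {0..a} (\<lambda>s. (\<lambda>(t, u). f t u) (s, w s))"
      using that by (intro continuous_on_compose2[OF assms(6)] continuous_intros) auto
    then show ?thesis unfolding G_def by (auto intro!: continuous_intros)
  qed
  have Gy: "continuous_on {0..a} (G y)" and Gz: "continuous_on {0..a} (G z)"
    using G yz yzJ by blast+
  have D: "continuous_on {0..a} D"
    unfolding D_def using Gy Gz by (intro continuous_intros)
  have I_diff: "I (G y) t - I (G z) t = I D t" if "t \<in> {0..a}" for t
  proof -
    have "continuous_on {0..t} (G y)" "continuous_on {0..t} (G z)"
      using Gy Gz that by (auto elim: continuous_on_subset)
    then show ?thesis
      unfolding I_def D_def right_diff_distrib using that assms(1)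
      by (intro Henstock_Kurzweil_Integration.integral_diff[symmetric] integrable_powr_diff_mult) auto
  qed
  have "continuous_on {0..a} (\<lambda>t. y t - z t)"
    using yz by (intro continuous_intros)
  then obtain t where t: "t \<in> {0..a}" "M = \<bar>y t - z t\<bar>"
    and M: "\<And>s. s \<in> {0..a} \<Longrightarrow> \<bar>y s - z s\<bar> \<le> M"
    using sup_norm_attained[of a "\<lambda>t. y t - z t"] assms(4) unfolding M_def by force
  have M0: "0 \<le> M" using t by simp
  then have K0: "0 \<le> K" using assms(8) by (simp add: K_def)
  have DK: "\<bar>D s\<bar> \<le> K" if s: "s \<in> {0..a}" for s
  proof -
    have "\<bar>f s (y s) - f s (z s)\<bar> \<le> L * \<bar>y s - z s\<bar>"
      using assms(7) s yzJ by blast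
    also have "\<dots> \<le> L * M"
      using M[OF s] assms(8) by (intro mult_left_mono) auto
    finally have "exp (lam * s) * \<bar>f s (y s) - f s (z s)\<bar> \<le> K"
      unfolding K_def using s assms(3) by (intro mult_mono) (auto intro: mult_left_mono)
    moreover have "\<bar>D s\<bar> = exp (lam * s) * \<bar>f s (y s) - f s (z s)\<bar>"
      by (simp add: D_def G_def abs_mult flip: right_diff_distrib)
    ultimately show ?thesis by simp
  qed
  \<comment> \<open>Needed both at \<open>r = t\<close> and at \<open>r = a\<close>, which is the
    source of the factor 2 in \<open>\<beta>\<close>. The bound is uniform because
    \<open>r powr \<alpha>\<close> increases with \<open>r\<close>.\<close>
  have I_le: "\<bar>I D r\<bar> \<le> K * (a powr \<alpha> / \<alpha>)" if r: "r \<in> {0..a}" for r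
  proof -
    have "\<bar>I D r\<bar> \<le> K * (r powr \<alpha> / \<alpha>)"
      unfolding I_def using r assms(1) DK D
      by (intro abs_integral_powr_diff_mult_le) (auto elim: continuous_on_subset)
    also have "\<dots> \<le> K * (a powr \<alpha> / \<alpha>)"
      using r assms(1) K0 by (intro mult_left_mono divide_right_mono powr_mono2) auto
    finally show ?thesis .
  qed
  have \<Gamma>: "0 < Gamma \<alpha>" "Gamma (\<alpha> + 1) = \<alpha> * Gamma \<alpha>" "0 < Gamma (\<alpha> + 1)"
    using assms(1) by (auto simp: Gamma_real_pos intro!: Gamma_plus1)
  have sol: "w t = exp (- lam * t) * (wa + (I (G w) t - I (G w) a) / Gamma \<alpha>)"
    if "is_tvp_solution \<alpha> lam a J f wa w" for w wa
    using that t(1) unfolding is_tvp_solution_def I_def G_def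
    by (auto simp: algebra_simps diff_divide_distrib)
  have "y t - z t = exp (- lam * t) * (ya - za + (I D t - I D a) / Gamma \<alpha>)"
    unfolding sol[OF assms(10)] sol[OF assms(11)] I_diff[OF t(1), symmetric]
    using I_diff[of a] assms(4) by (simp add: algebra_simps diff_divide_distrib add_divide_distrib)
  then have "M = exp (- lam * t) * \<bar>ya - za + (I D t - I D a) / Gamma \<alpha>\<bar>"
    by (simp add: t(2) abs_mult)
  also have "\<dots> \<le> \<bar>ya - za + (I D t - I D a) / Gamma \<alpha>\<bar>"
    using t(1) assms(3) by (intro mult_left_le_one_le) auto
  also have "\<dots> \<le> \<bar>ya - za\<bar> + \<bar>I D t - I D a\<bar> / Gamma \<alpha>"
    using abs_triangle_ineq[of "ya - za" "(I D t - I D a) / Gamma \<alpha>"] \<Gamma>(1) by simp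
  also have "\<dots> \<le> \<bar>ya - za\<bar> + 2 * (K * (a powr \<alpha> / \<alpha>)) / Gamma \<alpha>"
    using I_le[OF t(1)] I_le[of a] assms(4) \<Gamma>(1) by (intro add_left_mono divide_right_mono) auto
  \<comment> \<open>The factors \<open>\<alpha>\<close> and \<open>Gamma \<alpha>\<close> in the
    denominators combine to \<open>Gamma (\<alpha> + 1)\<close>.\<close>
  also have "\<dots> = \<bar>ya - za\<bar> + (1 - \<beta>) * M"
    by (simp add: \<beta>_def K_def \<Gamma>(2))
  finally have "M * \<beta> \<le> \<bar>ya - za\<bar>"
    by (simp add: algebra_simps)
  \<comment> \<open>This is the upper bound on \<open>L\<close>, rearranged; it allows dividing by
    \<open>\<beta>\<close>.\<close>
  moreover have "0 < \<beta>"
    using assms(4,9) \<Gamma>(3) by (simp add: \<beta>_def field_simps)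
  ultimately show ?thesis
    unfolding Let_def \<beta>_def[symmetric] M_def[symmetric] by (simp add: field_simps)
qed

end
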